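(* Let $A$ be a bounded pseudo-BCK algebra, let $s$ be a Bosbach state on $A$ and let $K=\mathrm{Ker}(s)$. Then $(A/K,\oplus,{}^-,0/K)$, where $$a/K\oplus b/K=(a^{\sim}\rightarrow b)/K\quad\text{and}\quad (a/K)^-=a^-/K,$$ is an archimedean MV-algebra, and the map $\hat s(a/K):=s(a)$ is an MV-state on this MV-algebra.
   Context: A pseudo-BCK algebra is a structure $(A,\le,\rightarrow,\rightsquigarrow,1)$ with $\le$ a binary relation, $\rightarrow,\rightsquigarrow$ binary operations and $1\in A$, such that for all $x,y,z\in A$: $x\rightarrow y\le (y\rightarrow z)\rightsquigarrow(x\rightarrow z)$ and $x\rightsquigarrow y\le (y\rightsquigarrow z)\rightarrow(x\rightsquigarrow z)$; $x\le (x\rightarrow y)\rightsquigarrow y$ and $x\le (x\rightsquigarrow y)\rightarrow y$; $x\le x$; $x\le 1$; $x\le y$ and $y\le x$ imply $x=y$; $x\le y$ iff $x\rightarrow y=1$ iff $x\rightsquigarrow y=1$. Then $\le$ is a partial order. $A$ is bounded if it has a least element $0$; then $x^-:=x\rightarrow 0$, $x^\sim:=x\rightsquigarrow 0$. A filter of $A$ is a set $F$ with $1\in F$ such that $a\in F$, $a\rightarrow b\in F$ imply $b\in F$; it is normal if $a\rightarrow b\in F\iff a\rightsquigarrow b\in F$. For a normal filter $F$, the relation $a\,\Theta_F\, b\iff a\rightarrow b\in F$ and $b\rightarrow a\in F$ is a congruence and $A/F$ denotes the quotient pseudo-BCK algebra with classes $a/F$. A Bosbach state on a bounded pseudo-BCK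 algebra is a map $s:A\to[0,1]$ with $s(x)+s(x\rightarrow y)=s(y)+s(y\rightarrow x)$, $s(x)+s(x\rightsquigarrow y)=s(y)+s(y\rightsquigarrow x)$ for all $x,y$, $s(0)=0$, $s(1)=1$; its kernel is $\mathrm{Ker}(s)=\{a\in A: s(a)=1\}$ (a normal filter). An MV-algebra is an algebra $(M,\oplus,{}^-,0)$ with $\oplus$ commutative and associative, $x\oplus 0=x$, $x\oplus 0^-=0^-$, $x^{--}=x$, $y\oplus(y\oplus x^-)^-=x\oplus(x\oplus y^-)^-$; it is archimedean if $nx\le x^-$ for all $n\in\mathbb N$ implies $x=0$ (where $nx=x\oplus\cdots\oplus x$, $n$ times). An MV-state is a map $\mu:M\to[0,1]$ with $\mu(0^-)=1$ and $\mu(a\oplus b)=\mu(a)+\mu(b)$ whenever $(a^-\oplus b^-)^-=0$. *)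

theory Defs
  imports Complex_Main "HOL-Library.FuncSet" "HOL-Algebra.Congruence"
begin

no_notation funcset (infixr \<open>\<rightarrow>\<close> 60)

record 'a pseudo_BCK = "'a partial_object" +
  pBCK_le :: "'a \<Rightarrow> 'a \<Rightarrow> bool" (infix \<open>\<preceq>\<index>\<close> 50)
  pBCK_imp :: "'a \<Rightarrow> 'a \<Rightarrow> 'a" (infixr \<open>\<rightarrow>\<index>\<close> 65)
  pBCK_limp :: "'a \<Rightarrow> 'a \<Rightarrow> 'a" (infixr \<open>\<leadsto>\<index>\<close> 65)
  pBCK_one :: 'a (\<open>\<one>\<index>\<close>)

locale pseudo_BCK_algebra =
  fixes A :: "('a, 'm) pseudo_BCK_scheme" (structure)
  assumes imp_closed: "\<lbrakk>x \<in> carrier A; y \<in> carrier A\<rbrakk> \<Longrightarrow> x \<rightarrow> y \<in> carrier A"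
    and limp_closed: "\<lbrakk>x \<in> carrier A; y \<in> carrier A\<rbrakk> \<Longrightarrow> x \<leadsto> y \<in> carrier A"
    and one_closed: "\<one> \<in> carrier A"
    and imp_trans: "\<lbrakk>x \<in> carrier A; y \<in> carrier A; z \<in> carrier A\<rbrakk> \<Longrightarrow>
          x \<rightarrow> y \<preceq> (y \<rightarrow> z) \<leadsto> (x \<rightarrow> z)"
    and limp_trans: "\<lbrakk>x \<in> carrier A; y \<in> carrier A; z \<in> carrier A\<rbrakk> \<Longrightarrow>
          x \<leadsto> y \<preceq> (y \<leadsto> z) \<rightarrow> (x \<leadsto> z)"
    and le_imp_limp: "\<lbrakk>x \<in> carrier A; y \<in> carrier A\<rbrakk> \<Longrightarrow> x \<preceq> (x \<rightarrow> y) \<leadsto> y"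
    and le_limp_imp: "\<lbrakk>x \<in> carrier A; y \<in> carrier A\<rbrakk> \<Longrightarrow> x \<preceq> (x \<leadsto> y) \<rightarrow> y"
    and le_refl: "x \<in> carrier A \<Longrightarrow> x \<preceq> x"
    and le_one: "x \<in> carrier A \<Longrightarrow> x \<preceq> \<one>"
    and le_antisym: "\<lbrakk>x \<in> carrier A; y \<in> carrier A; x \<preceq> y; y \<preceq> x\<rbrakk> \<Longrightarrow> x = y"
    and le_iff_imp: "\<lbrakk>x \<in> carrier A; y \<in> carrier A\<rbrakk> \<Longrightarrow> x \<preceq> y \<longleftrightarrow> x \<rightarrow> y = \<one>"
    and le_iff_limp: "\<lbrakk>x \<in> carrier A; y \<in> carrier A\<rbrakk> \<Longrightarrow> x \<preceq> y \<longleftrightarrow> x \<leadsto> y = \<one>"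

record 'a bounded_pseudo_BCK = "'a pseudo_BCK" +
  pBCK_zero :: 'a (\<open>\<zero>\<index>\<close>)

locale bounded_pseudo_BCK_algebra = pseudo_BCK_algebra A
  for A :: "('a, 'm) bounded_pseudo_BCK_scheme" (structure) +
  assumes zero_closed: "\<zero> \<in> carrier A"
    and zero_le: "x \<in> carrier A \<Longrightarrow> \<zero> \<preceq> x"

definition pBCK_neg :: "('a, 'm) bounded_pseudo_BCK_scheme \<Rightarrow> 'a \<Rightarrow> 'a" where
  "pBCK_neg A x = x \<rightarrow>\<^bsub>A\<^esub> \<zero>\<^bsub>A\<^esub>"

definition pBCK_til :: "('a, 'm) bounded_pseudo_BCK_scheme \<Rightarrow> 'a \<Rightarrow> 'a" where
  "pBCK_til A x = x \<leadsto>\<^bsub>A\<^esub> \<zero>\<^bsub>A\<^esub>"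

definition filter_rel :: "('a, 'm) pseudo_BCK_scheme \<Rightarrow> 'a set \<Rightarrow> ('a \<times> 'a) set" where
  "filter_rel A F = {(a, b). a \<in> carrier A \<and> b \<in> carrier A \<and>
     a \<rightarrow>\<^bsub>A\<^esub> b \<in> F \<and> b \<rightarrow>\<^bsub>A\<^esub> a \<in> F}"

definition filter_class :: "('a, 'm) pseudo_BCK_scheme \<Rightarrow> 'a set \<Rightarrow> 'a \<Rightarrow> 'a set" where
  "filter_class A F a = filter_rel A F `` {a}"

locale Bosbach_state = bounded_pseudo_BCK_algebra A
  for A :: "('a, 'm) bounded_pseudo_BCK_scheme" (structure) and s :: "'a \<Rightarrow> real" +
  assumes state_range: "x \<in> carrier A \<Longrightarrow> s x \<in> {0..1}"
    and state_imp: "\<lbrakk>x \<in> carrier A; y \<in> carrier A\<rbrakk> \<Longrightarrow> s x + s (x \<rightarrow> y) = s y + s (y \<rightarrow> x)"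
    and state_limp: "\<lbrakk>x \<in> carrier A; y \<in> carrier A\<rbrakk> \<Longrightarrow> s x + s (x \<leadsto> y) = s y + s (y \<leadsto> x)"
    and state_zero: "s \<zero> = 0"
    and state_one: "s \<one> = 1"

definition state_ker :: "('a, 'm) pseudo_BCK_scheme \<Rightarrow> ('a \<Rightarrow> real) \<Rightarrow> 'a set" where
  "state_ker A s = {a \<in> carrier A. s a = 1}"

record 'a MV = "'a partial_object" +
  MV_plus :: "'a \<Rightarrow> 'a \<Rightarrow> 'a" (infixl \<open>\<oplus>\<index>\<close> 65)
  MV_neg :: "'a \<Rightarrow> 'a" (\<open>\<ominus>\<index> _\<close> [81] 80)
  MV_zero :: 'a

locale MV_algebra =
  fixes M :: "('a, 'm) MV_scheme" (structure)
  assumes plus_closed: "\<lbrakk>x \<in> carrier M; y \<in> carrier M\<rbrakk> \<Longrightarrow> x \<oplus> y \<in> carrier M"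
    and neg_closed: "x \<in> carrier M \<Longrightarrow> \<ominus> x \<in> carrier M"
    and zero_closed: "MV_zero M \<in> carrier M"
    and plus_comm: "\<lbrakk>x \<in> carrier M; y \<in> carrier M\<rbrakk> \<Longrightarrow> x \<oplus> y = y \<oplus> x"
    and plus_assoc: "\<lbrakk>x \<in> carrier M; y \<in> carrier M; z \<in> carrier M\<rbrakk> \<Longrightarrow>
          (x \<oplus> y) \<oplus> z = x \<oplus> (y \<oplus> z)"
    and plus_zero: "x \<in> carrier M \<Longrightarrow> x \<oplus> MV_zero M = x"
    and plus_neg_zero: "x \<in> carrier M \<Longrightarrow> x \<oplus> \<ominus> MV_zero M = \<ominus> MV_zero M"
    and neg_neg: "x \<in> carrier M \<Longrightarrow> \<ominus> (\<ominus> x) = x"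
    and lukasiewicz: "\<lbrakk>x \<in> carrier M; y \<in> carrier M\<rbrakk> \<Longrightarrow>
          y \<oplus> \<ominus> (y \<oplus> \<ominus> x) = x \<oplus> \<ominus> (x \<oplus> \<ominus> y)"

text \<open>The natural order of an MV-algebra, with top element \<open>\<ominus> 0\<close>.\<close>

definition MV_le :: "('a, 'm) MV_scheme \<Rightarrow> 'a \<Rightarrow> 'a \<Rightarrow> bool" where
  "MV_le M x y \<longleftrightarrow> \<ominus>\<^bsub>M\<^esub> x \<oplus>\<^bsub>M\<^esub> y = \<ominus>\<^bsub>M\<^esub> MV_zero M"

primrec MV_mult :: "('a, 'm) MV_scheme \<Rightarrow> nat \<Rightarrow> 'a \<Rightarrow> 'a" where
  "MV_mult M 0 x = MV_zero M"
| "MV_mult M (Suc n) x = MV_mult M n x \<oplus>\<^bsub>M\<^esub> x"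

locale archimedean_MV_algebra = MV_algebra M
  for M :: "('a, 'm) MV_scheme" (structure) +
  assumes archimedean: "\<lbrakk>x \<in> carrier M; \<And>n. MV_le M (MV_mult M n x) (\<ominus> x)\<rbrakk> \<Longrightarrow> x = MV_zero M"

locale MV_state = MV_algebra M
  for M :: "('a, 'm) MV_scheme" (structure) and \<mu> :: "'a \<Rightarrow> real" +
  assumes state_range: "x \<in> carrier M \<Longrightarrow> \<mu> x \<in> {0..1}"
    and state_one: "\<mu> (\<ominus> MV_zero M) = 1"
    and state_add: "\<lbrakk>a \<in> carrier M; b \<in> carrier M; \<ominus> (\<ominus> a \<oplus> \<ominus> b) = MV_zero M\<rbrakk> \<Longrightarrow>
          \<mu> (a \<oplus> b) = \<mu> a + \<mu> b"

text \<open>The operations and the induced map are given by representatives, in the style of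
  \<^theory>\<open>HOL.Equiv_Relations\<close>. These terms are meaningful only when the result does not
  depend on the representatives, which therefore has to be claimed wherever they are used.\<close>

definition quotient_MV ::
    "('a, 'm) bounded_pseudo_BCK_scheme \<Rightarrow> 'a set \<Rightarrow> 'a set MV" where
  "quotient_MV A F =
     \<lparr>carrier = carrier A // filter_rel A F,
      MV_plus = (\<lambda>X Y. \<Union>a\<in>X. \<Union>b\<in>Y. filter_class A F (pBCK_til A a \<rightarrow>\<^bsub>A\<^esub> b)),
      MV_neg = (\<lambda>X. \<Union>a\<in>X. filter_class A F (pBCK_neg A a)),
      MV_zero = filter_class A F \<zero>\<^bsub>A\<^esub>\<rparr>"

definition quotient_map :: "('a \<Rightarrow> real) \<Rightarrow> 'a set \<Rightarrow> real" where
  "quotient_map s X = the_elem (s ` X)"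

end

theory Submission
  imports Defs
begin

text \<open>
  Passing to the quotient by the kernel makes the state faithful: \<open>s x = 1\<close> only for \<open>x = 1\<close>.
  Then \<open>(a \<rightarrow> b) \<leadsto> b\<close> is the join of \<open>a\<close> and \<open>b\<close>, double negations cancel, and all that
  separates the quotient from an MV-algebra is the equality of the two implications. Every
  Bosbach functional, with \<open>s 0 = 0\<close> not required, satisfies \<open>s (a \<rightarrow> b) = s (a \<leadsto> b)\<close>.
  For each element \<open>c\<close> the map \<open>\<sigma> x = lim s (c \<rightarrow> (c \<rightarrow> ... \<rightarrow> x))\<close>, which is the part of \<open>s\<close>
  living where \<open>c\<close> equals 1, is again a Bosbach functional. Put \<open>p = a \<rightarrow> b\<close>, \<open>q = a \<leadsto> b\<close>
  and \<open>c = p \<rightarrow> q\<close>. From \<open>\<sigma> p = \<sigma> q\<close> one gets \<open>\<sigma> (q \<rightarrow> p) = \<sigma> (p \<rightarrow> q) = 1\<close>, whereas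
  \<open>c \<rightarrow> (q \<rightarrow> p) = q \<rightarrow> p\<close> gives \<open>\<sigma> (q \<rightarrow> p) = s (q \<rightarrow> p)\<close>. Hence \<open>q \<le> p\<close>, and \<open>p \<le> q\<close>
  by symmetry.
\<close>

section \<open>Pseudo-BCK algebras\<close>

context pseudo_BCK_algebra
begin

declare imp_closed [simp, intro] limp_closed [simp, intro] one_closed [simp, intro]
  le_refl [simp, intro] le_one [simp, intro]

lemma one_le_iff: "x \<in> carrier A \<Longrightarrow> \<one> \<preceq> x \<longleftrightarrow> x = \<one>"
  using le_antisym by auto

lemma imp_refl [simp]: "x \<in> carrier A \<Longrightarrow> x \<rightarrow> x = \<one>"
  using le_iff_imp by blast

lemma limp_refl [simp]: "x \<in> carrier A \<Longrightarrow> x \<leadsto> x = \<one>"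
  using le_iff_limp by blast

lemma imp_one [simp]: "x \<in> carrier A \<Longrightarrow> x \<rightarrow> \<one> = \<one>"
  using le_iff_imp by blast

lemma imp_antimono:
  assumes "x \<preceq> y" "x \<in> carrier A" "y \<in> carrier A" "z \<in> carrier A"
  shows "y \<rightarrow> z \<preceq> x \<rightarrow> z"
  using imp_trans [of x y z] assms by (simp add: le_iff_imp [of x y] one_le_iff le_iff_limp [of "y \<rightarrow> z"])

lemma limp_antimono:
  assumes "x \<preceq> y" "x \<in> carrier A" "y \<in> carrier A" "z \<in> carrier A"
  shows "y \<leadsto> z \<preceq> x \<leadsto> z"
  using limp_trans [of x y z] assms by (simp add: le_iff_limp [of x y] one_le_iff le_iff_imp [of "y \<leadsto> z"])

lemma le_trans:
  assumes "x \<preceq> y" "y \<preceq> z" "x \<in> carrier A" "y \<in> carrier A" "z \<in> carrier A"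
  shows "x \<preceq> z"
  using imp_antimono [of x y z] assms by (simp add: le_iff_imp [of y z] one_le_iff le_iff_imp [of x z])

text \<open>The two arrows into a fixed \<open>z\<close> form an antitone Galois connection: both
  are antitone, and \<open>le_imp_limp\<close>, \<open>le_limp_imp\<close> are the unit
  inequalities.\<close>

lemma le_imp_iff_le_limp:
  assumes "x \<in> carrier A" "y \<in> carrier A" "z \<in> carrier A"
  shows "x \<preceq> y \<rightarrow> z \<longleftrightarrow> y \<preceq> x \<leadsto> z"
proof
  assume "x \<preceq> y \<rightarrow> z"
  then have "(y \<rightarrow> z) \<leadsto> z \<preceq> x \<leadsto> z"
    using assms by (intro limp_antimono) auto
  then show "y \<preceq> x \<leadsto> z"
    using le_trans [OF le_imp_limp [of y z]] assms by simp
next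
  assume "y \<preceq> x \<leadsto> z"
  then have "(x \<leadsto> z) \<rightarrow> z \<preceq> y \<rightarrow> z"
    using assms by (intro imp_antimono) auto
  then show "x \<preceq> y \<rightarrow> z"
    using le_trans [OF le_limp_imp [of x z]] assms by simp
qed

text \<open>Transitivity through \<open>y \<leadsto> z\<close> produces the premise
  \<open>(y \<leadsto> z) \<rightarrow> z\<close>; it lies above \<open>y\<close>, so antitonicity
  puts \<open>y\<close> in its place. The other inequality is dual.\<close>

lemma imp_limp_exchange:
  assumes "x \<in> carrier A" "y \<in> carrier A" "z \<in> carrier A"
  shows "x \<rightarrow> (y \<leadsto> z) = y \<leadsto> (x \<rightarrow> z)"
proof (rule le_antisym)
  have "((y \<leadsto> z) \<rightarrow> z) \<leadsto> (x \<rightarrow> z) \<preceq> y \<leadsto> (x \<rightarrow> z)"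
    using assms by (intro limp_antimono le_limp_imp) auto
  then show "x \<rightarrow> (y \<leadsto> z) \<preceq> y \<leadsto> (x \<rightarrow> z)"
    using le_trans [OF imp_trans [of x "y \<leadsto> z" z]] assms by simp
  have "((x \<rightarrow> z) \<leadsto> z) \<rightarrow> (y \<leadsto> z) \<preceq> x \<rightarrow> (y \<leadsto> z)"
    using assms by (intro imp_antimono le_imp_limp) auto
  then show "y \<leadsto> (x \<rightarrow> z) \<preceq> x \<rightarrow> (y \<leadsto> z)"
    using le_trans [OF limp_trans [of y "x \<rightarrow> z" z]] assms by simp
qed (use assms in auto)

lemma one_imp [simp]:
  assumes "x \<in> carrier A"
  shows "\<one> \<rightarrow> x = x"
proof (rule le_antisym)
  show "\<one> \<rightarrow> x \<preceq> x"
    using le_imp_limp [of \<one> x] assms by (simp add: one_le_iff le_iff_limp [of "\<one> \<rightarrow> x"])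
  show "x \<preceq> \<one> \<rightarrow> x"
    using assms by (simp add: le_imp_iff_le_limp)
qed (use assms in auto)

lemma one_limp [simp]:
  assumes "x \<in> carrier A"
  shows "\<one> \<leadsto> x = x"
proof (rule le_antisym)
  show "\<one> \<leadsto> x \<preceq> x"
    using le_limp_imp [of \<one> x] assms by (simp add: one_le_iff le_iff_imp [of "\<one> \<leadsto> x"])
  show "x \<preceq> \<one> \<leadsto> x"
    using assms by (simp flip: le_imp_iff_le_limp)
qed (use assms in auto)

lemma le_imp_self: "\<lbrakk>x \<in> carrier A; y \<in> carrier A\<rbrakk> \<Longrightarrow> y \<preceq> x \<rightarrow> y"
  by (simp add: le_imp_iff_le_limp)

lemma le_limp_self: "\<lbrakk>x \<in> carrier A; y \<in> carrier A\<rbrakk> \<Longrightarrow> y \<preceq> x \<leadsto> y"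
  by (simp flip: le_imp_iff_le_limp)

lemma imp_prefix:
  assumes "x \<in> carrier A" "y \<in> carrier A" "z \<in> carrier A"
  shows "x \<rightarrow> y \<preceq> (z \<rightarrow> x) \<rightarrow> (z \<rightarrow> y)"
  using imp_trans [of z x y] assms by (simp add: le_imp_iff_le_limp)

lemma limp_prefix:
  assumes "x \<in> carrier A" "y \<in> carrier A" "z \<in> carrier A"
  shows "x \<leadsto> y \<preceq> (z \<leadsto> x) \<leadsto> (z \<leadsto> y)"
  using limp_trans [of z x y] assms by (simp flip: le_imp_iff_le_limp)

lemma imp_mono:
  assumes "x \<preceq> y" "x \<in> carrier A" "y \<in> carrier A" "z \<in> carrier A"
  shows "z \<rightarrow> x \<preceq> z \<rightarrow> y"
  using imp_prefix [of x y z] assms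
  by (simp add: le_iff_imp [of x y] one_le_iff le_iff_imp [of "z \<rightarrow> x"])

text \<open>Triple-implication law of the Galois connection. It lets
  \<open>(x \<rightarrow> y) \<leadsto> y\<close>, later a join, stand in for \<open>x\<close> in
  front of \<open>y\<close>.\<close>

lemma imp_limp_imp:
  assumes "x \<in> carrier A" "y \<in> carrier A"
  shows "((x \<rightarrow> y) \<leadsto> y) \<rightarrow> y = x \<rightarrow> y"
  by (rule le_antisym) (use assms in \<open>auto intro: imp_antimono le_imp_limp le_limp_imp\<close>)

lemma limp_imp_limp:
  assumes "x \<in> carrier A" "y \<in> carrier A"
  shows "((x \<leadsto> y) \<rightarrow> y) \<leadsto> y = x \<leadsto> y"
  by (rule le_antisym) (use assms in \<open>auto intro: limp_antimono le_imp_limp le_limp_imp\<close>)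

section \<open>Iterates of \<open>c \<rightarrow> _\<close>\<close>

lemma imp_iterate_closed [simp, intro]:
  "\<lbrakk>c \<in> carrier A; x \<in> carrier A\<rbrakk> \<Longrightarrow> (pBCK_imp A c ^^ n) x \<in> carrier A"
  by (induction n) auto

lemma imp_iterate_mono:
  "\<lbrakk>x \<preceq> y; c \<in> carrier A; x \<in> carrier A; y \<in> carrier A\<rbrakk>
    \<Longrightarrow> (pBCK_imp A c ^^ n) x \<preceq> (pBCK_imp A c ^^ n) y"
  by (induction n) (auto intro: imp_mono)

lemma le_imp_iterate:
  "\<lbrakk>c \<in> carrier A; x \<in> carrier A\<rbrakk> \<Longrightarrow> x \<preceq> (pBCK_imp A c ^^ n) x"
proof (induction n)
  case (Suc n)
  then show ?case
    using le_trans [OF _ le_imp_self [of c "(pBCK_imp A c ^^ n) x"]] by simp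
qed auto

lemma imp_iterate_prefix:
  "\<lbrakk>c \<in> carrier A; x \<in> carrier A; y \<in> carrier A\<rbrakk>
    \<Longrightarrow> x \<rightarrow> y \<preceq> (pBCK_imp A c ^^ n) x \<rightarrow> (pBCK_imp A c ^^ n) y"
proof (induction n)
  case (Suc n)
  then show ?case
    using le_trans [OF _ imp_prefix [of "(pBCK_imp A c ^^ n) x" "(pBCK_imp A c ^^ n) y" c]] by simp
qed auto

lemma limp_imp_iterate:
  "\<lbrakk>c \<in> carrier A; x \<in> carrier A; y \<in> carrier A\<rbrakk>
    \<Longrightarrow> x \<leadsto> (pBCK_imp A c ^^ n) y = (pBCK_imp A c ^^ n) (x \<leadsto> y)"
proof (induction n)
  case (Suc n)
  then show ?case
    using imp_limp_exchange [of c x "(pBCK_imp A c ^^ n) y"] by simp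
qed auto

lemma imp_iterate_one [simp]: "c \<in> carrier A \<Longrightarrow> (pBCK_imp A c ^^ n) \<one> = \<one>"
  by (induction n) auto

end

section \<open>Bosbach functionals\<close>

locale Bosbach_functional = pseudo_BCK_algebra A
  for A :: "('a, 'm) pseudo_BCK_scheme" (structure) and s :: "'a \<Rightarrow> real" +
  assumes functional_le_one: "x \<in> carrier A \<Longrightarrow> s x \<le> 1"
    and functional_one [simp]: "s \<one> = 1"
    and functional_imp:
      "\<lbrakk>x \<in> carrier A; y \<in> carrier A\<rbrakk> \<Longrightarrow> s x + s (x \<rightarrow> y) = s y + s (y \<rightarrow> x)"
    and functional_limp:
      "\<lbrakk>x \<in> carrier A; y \<in> carrier A\<rbrakk> \<Longrightarrow> s x + s (x \<leadsto> y) = s y + s (y \<leadsto> x)"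
begin

lemma functional_imp_le:
  "\<lbrakk>y \<preceq> x; x \<in> carrier A; y \<in> carrier A\<rbrakk> \<Longrightarrow> s (x \<rightarrow> y) = 1 + s y - s x"
  using functional_imp [of x y] le_iff_imp [of y x] by simp

lemma functional_limp_le:
  "\<lbrakk>y \<preceq> x; x \<in> carrier A; y \<in> carrier A\<rbrakk> \<Longrightarrow> s (x \<leadsto> y) = 1 + s y - s x"
  using functional_limp [of x y] le_iff_limp [of y x] by simp

lemma functional_mono:
  assumes "y \<preceq> x" "x \<in> carrier A" "y \<in> carrier A"
  shows "s y \<le> s x"
  using functional_imp_le [OF assms] functional_le_one [of "x \<rightarrow> y"] assms by simp

lemma functional_imp_limp:
  assumes "x \<in> carrier A" "y \<in> carrier A"
  shows "s ((x \<rightarrow> y) \<leadsto> y) = 1 + s y - s (x \<rightarrow> y)"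
  using assms by (simp add: functional_limp_le le_imp_self)

lemma functional_limp_imp:
  assumes "x \<in> carrier A" "y \<in> carrier A"
  shows "s ((x \<leadsto> y) \<rightarrow> y) = 1 + s y - s (x \<leadsto> y)"
  using assms by (simp add: functional_imp_le le_limp_self)

text \<open>Double implication into \<open>b\<close> is monotone, and \<open>b \<preceq> c\<close>
  gives \<open>(c \<rightarrow> b) \<leadsto> b\<close> the same value as \<open>c\<close>. As far
  as \<open>s\<close> can see, \<open>(a \<rightarrow> b) \<leadsto> b\<close> is a least upper
  bound.\<close>

lemma functional_upper_bound_imp_limp:
  assumes "a \<preceq> c" "b \<preceq> c" "a \<in> carrier A" "b \<in> carrier A" "c \<in> carrier A"
  shows "s ((a \<rightarrow> b) \<leadsto> b) \<le> s c"
proof -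
  have "(a \<rightarrow> b) \<leadsto> b \<preceq> (c \<rightarrow> b) \<leadsto> b"
    using assms by (intro limp_antimono imp_antimono) auto
  then have "s ((a \<rightarrow> b) \<leadsto> b) \<le> s ((c \<rightarrow> b) \<leadsto> b)"
    using assms by (intro functional_mono) auto
  then show ?thesis
    using assms functional_imp_le [of b c] by (simp add: functional_imp_limp)
qed

lemma functional_upper_bound_limp_imp:
  assumes "a \<preceq> c" "b \<preceq> c" "a \<in> carrier A" "b \<in> carrier A" "c \<in> carrier A"
  shows "s ((a \<leadsto> b) \<rightarrow> b) \<le> s c"
proof -
  have "(a \<leadsto> b) \<rightarrow> b \<preceq> (c \<leadsto> b) \<rightarrow> b"
    using assms by (intro limp_antimono imp_antimono) auto
  then have "s ((a \<leadsto> b) \<rightarrow> b) \<le> s ((c \<leadsto> b) \<rightarrow> b)"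
    using assms by (intro functional_mono) auto
  then show ?thesis
    using assms functional_limp_le [of b c] by (simp add: functional_limp_imp)
qed

text \<open>Both double implications are upper bounds of \<open>a\<close> and \<open>b\<close>, so
  each has a value at most that of the other; these values are \<open>1 + s b\<close> minus the two
  quantities compared.\<close>

lemma functional_imp_eq_limp:
  assumes "a \<in> carrier A" "b \<in> carrier A"
  shows "s (a \<rightarrow> b) = s (a \<leadsto> b)"
proof -
  have "s ((a \<rightarrow> b) \<leadsto> b) \<le> s ((a \<leadsto> b) \<rightarrow> b)"
    using assms by (intro functional_upper_bound_imp_limp le_limp_imp le_limp_self) (auto intro: le_imp_self)
  moreover have "s ((a \<leadsto> b) \<rightarrow> b) \<le> s ((a \<rightarrow> b) \<leadsto> b)"
    using assms by (intro functional_upper_bound_limp_imp le_imp_limp le_limp_self) auto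
  ultimately show ?thesis
    using assms by (simp add: functional_imp_limp functional_limp_imp)
qed

text \<open>The outermost \<open>c \<rightarrow> _\<close> may become \<open>c \<leadsto> _\<close>
  without changing the value, and then slides inside the remaining iterates. Hence the induction
  varies \<open>x\<close>.\<close>

lemma functional_imp_iterate_eq_limp_iterate:
  "\<lbrakk>c \<in> carrier A; x \<in> carrier A\<rbrakk> \<Longrightarrow> s ((pBCK_imp A c ^^ n) x) = s ((pBCK_limp A c ^^ n) x)"
proof (induction n arbitrary: x)
  case (Suc n)
  have "s ((pBCK_imp A c ^^ Suc n) x) = s (c \<leadsto> (pBCK_imp A c ^^ n) x)"
    using Suc.prems by (simp add: functional_imp_eq_limp)
  also have "\<dots> = s ((pBCK_imp A c ^^ n) (c \<leadsto> x))"
    using Suc.prems by (simp add: limp_imp_iterate)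
  also have "\<dots> = s ((pBCK_limp A c ^^ n) (c \<leadsto> x))"
    using Suc by simp
  finally show ?case
    by (simp add: funpow_swap1)
qed auto

end

section \<open>The opposite algebra, and joins under a faithful functional\<close>

definition pBCK_opp :: "('a, 'm) pseudo_BCK_scheme \<Rightarrow> 'a pseudo_BCK" where
  "pBCK_opp A = \<lparr>carrier = carrier A, pBCK_le = pBCK_le A, pBCK_imp = pBCK_limp A,
     pBCK_limp = pBCK_imp A, pBCK_one = pBCK_one A\<rparr>"

lemma (in pseudo_BCK_algebra) pseudo_BCK_algebra_opp: "pseudo_BCK_algebra (pBCK_opp A)"
  by unfold_locales
    (simp_all add: pBCK_opp_def imp_trans limp_trans le_imp_limp le_limp_imp le_antisym
      flip: le_iff_imp le_iff_limp)

locale faithful_Bosbach_functional = Bosbach_functional +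
  assumes faithful: "\<lbrakk>x \<in> carrier A; s x = 1\<rbrakk> \<Longrightarrow> x = \<one>"
begin

lemma faithful_Bosbach_functional_opp: "faithful_Bosbach_functional (pBCK_opp A) s"
proof -
  interpret opp: pseudo_BCK_algebra "pBCK_opp A"
    by (rule pseudo_BCK_algebra_opp)
  show ?thesis
    by unfold_locales
      (auto simp: pBCK_opp_def functional_le_one functional_imp functional_limp intro: faithful)
qed

text \<open>Here \<open>s (y \<rightarrow> x) = 1 + s x - s y = 1\<close>, and faithfulness
  applies.\<close>

lemma eq_if_le_functional_eq:
  assumes "x \<preceq> y" "s x = s y" "x \<in> carrier A" "y \<in> carrier A"
  shows "x = y"
proof -
  have "y \<rightarrow> x = \<one>"
    using assms functional_imp_le [of x y] by (intro faithful) auto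
  then show ?thesis
    using assms by (intro le_antisym) (auto simp: le_iff_imp [of y x])
qed

text \<open>The inequality \<open>c \<preceq> (c \<rightarrow> b) \<leadsto> b\<close> holds between
  elements of equal value, so it is an equality, and monotonicity of double implication
  finishes.\<close>

lemma join_le:
  assumes "a \<preceq> c" "b \<preceq> c" "a \<in> carrier A" "b \<in> carrier A" "c \<in> carrier A"
  shows "(a \<rightarrow> b) \<leadsto> b \<preceq> c"
proof -
  have "s c = s ((c \<rightarrow> b) \<leadsto> b)"
    using assms functional_imp_le [of b c] by (simp add: functional_imp_limp)
  then have "c = (c \<rightarrow> b) \<leadsto> b"
    using assms by (intro eq_if_le_functional_eq le_imp_limp) auto
  moreover have "(a \<rightarrow> b) \<leadsto> b \<preceq> (c \<rightarrow> b) \<leadsto> b"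
    using assms by (intro limp_antimono imp_antimono) auto
  ultimately show ?thesis
    by simp
qed

lemma join_commute:
  assumes "a \<in> carrier A" "b \<in> carrier A"
  shows "(a \<rightarrow> b) \<leadsto> b = (b \<rightarrow> a) \<leadsto> a"
  by (rule le_antisym) (use assms in \<open>auto intro: join_le le_imp_limp le_limp_self\<close>)

lemma limp_imp_eq_join:
  assumes "a \<in> carrier A" "b \<in> carrier A"
  shows "(a \<leadsto> b) \<rightarrow> b = (a \<rightarrow> b) \<leadsto> b"
  using assms functional_imp_eq_limp [of a b]
  by (intro eq_if_le_functional_eq [symmetric] join_le le_limp_imp)
    (auto intro: le_imp_self simp: functional_imp_limp functional_limp_imp)

section \<open>Support functionals\<close>

definition support_functional :: "'a \<Rightarrow> 'a \<Rightarrow> real" where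
  "support_functional c x = lim (\<lambda>n. s ((pBCK_imp A c ^^ n) x))"

lemma support_functional_tendsto:
  assumes "c \<in> carrier A" "x \<in> carrier A"
  shows "(\<lambda>n. s ((pBCK_imp A c ^^ n) x)) \<longlonglongrightarrow> support_functional c x"
proof -
  have "incseq (\<lambda>n. s ((pBCK_imp A c ^^ n) x))"
    using assms by (intro incseq_SucI functional_mono) (auto intro: le_imp_self)
  moreover have "\<forall>n. s ((pBCK_imp A c ^^ n) x) \<le> 1"
    using assms by (auto intro: functional_le_one)
  ultimately show ?thesis
    unfolding support_functional_def
    by (metis incseq_convergent convergent_def convergent_LIMSEQ_iff)
qed

text \<open>Noncommutativity lets only \<open>x \<leadsto> y\<close> pass through the iterates of \<open>c \<rightarrow> _\<close>; the same for
  \<open>x \<rightarrow> y\<close> follows in the opposite algebra, whose support functionals are the same.\<close>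

lemma support_functional_limp_le:
  assumes "y \<preceq> x" and c: "c \<in> carrier A" and x: "x \<in> carrier A" and y: "y \<in> carrier A"
  shows "support_functional c (x \<leadsto> y) = 1 + support_functional c y - support_functional c x"
proof -
  define f where "f n z = (pBCK_imp A c ^^ n) z" for n z
  have f [simp]: "f n z \<in> carrier A" if "z \<in> carrier A" for n z
    using that c by (simp add: f_def)
  have lim: "(\<lambda>n. s (f n z)) \<longlonglongrightarrow> support_functional c z" if "z \<in> carrier A" for z
    using support_functional_tendsto [OF c that] by (simp add: f_def)
  \<comment> \<open>The upper estimate below prefixes \<open>n\<close> further implications to
    \<open>f n y\<close>, so it needs the limit along even indices.\<close>
  have lim2: "(\<lambda>n. s (f (n + n) y)) \<longlonglongrightarrow> support_functional c y"
    using LIMSEQ_subseq_LIMSEQ [OF lim [OF y], of "\<lambda>n. n + n"] by (simp add: strict_mono_def comp_def)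
  have exch: "s (f n (x \<leadsto> y)) = s (x \<rightarrow> f n y)" for n
    using c x y by (simp add: f_def functional_imp_eq_limp limp_imp_iterate)
  \<comment> \<open>Since \<open>x \<preceq> f n x\<close>, replacing the premise
    \<open>f n x\<close> by \<open>x\<close> can only raise the value.\<close>
  have lower: "1 + s (f n y) - s (f n x) \<le> s (f n (x \<leadsto> y))" for n
  proof -
    have "1 + s (f n y) - s (f n x) = s (f n x \<rightarrow> f n y)"
      using assms functional_imp_le [of "f n y" "f n x"] by (simp add: f_def imp_iterate_mono)
    also have "\<dots> \<le> s (x \<rightarrow> f n y)"
      using x y c by (intro functional_mono imp_antimono) (auto simp: f_def le_imp_iterate)
    finally show ?thesis
      by (simp add: exch)
  qed
  have upper: "s (f n (x \<leadsto> y)) \<le> 1 + s (f (n + n) y) - s (f n x)" for n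
  proof -
    have "x \<rightarrow> f n y \<preceq> f n x \<rightarrow> f (n + n) y"
      using imp_iterate_prefix [of c x "f n y" n] c x y by (simp add: f_def funpow_add)
    then have "s (x \<rightarrow> f n y) \<le> s (f n x \<rightarrow> f (n + n) y)"
      using x y by (intro functional_mono) auto
    also have "\<dots> \<le> 1 + s (f (n + n) y) - s (f n x)"
      using functional_imp [of "f n x" "f (n + n) y"] functional_le_one [of "f (n + n) y \<rightarrow> f n x"] x y
      by simp
    finally show ?thesis
      by (simp add: exch)
  qed
  show ?thesis
  proof (rule antisym)
    show "support_functional c (x \<leadsto> y) \<le> 1 + support_functional c y - support_functional c x"
      using LIMSEQ_le [OF lim tendsto_diff [OF tendsto_add [OF tendsto_const lim2] lim]] x y upper
      by blast
    show "1 + support_functional c y - support_functional c x \<le> support_functional c (x \<leadsto> y)"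
      using LIMSEQ_le [OF tendsto_diff [OF tendsto_add [OF tendsto_const lim] lim] lim] x y lower
      by blast
  qed
qed

lemma support_functional_imp_le:
  assumes "y \<preceq> x" and c: "c \<in> carrier A" and x: "x \<in> carrier A" and y: "y \<in> carrier A"
  shows "support_functional c (x \<rightarrow> y) = 1 + support_functional c y - support_functional c x"
proof -
  interpret opp: faithful_Bosbach_functional "pBCK_opp A" s
    by (rule faithful_Bosbach_functional_opp)
  have "opp.support_functional c z = support_functional c z" if "z \<in> carrier A" for z
    using c that
    unfolding opp.support_functional_def support_functional_def
    by (simp add: functional_imp_iterate_eq_limp_iterate pBCK_opp_def)
  then show ?thesis
    using opp.support_functional_limp_le [of y x c] assms by (simp add: pBCK_opp_def)
qed

text \<open>The comparable case suffices: with \<open>j\<close> the join of \<open>x\<close> and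
  \<open>y\<close>, the triple-implication law turns \<open>x \<rightarrow> y\<close> into
  \<open>j \<rightarrow> y\<close>, and both sides become
  \<open>1 + \<sigma> x + \<sigma> y - \<sigma> j\<close>, where \<open>\<sigma>\<close> is the
  support functional.\<close>

lemma Bosbach_functional_support_functional:
  assumes c: "c \<in> carrier A"
  shows "Bosbach_functional A (support_functional c)"
proof unfold_locales
  fix x assume x: "x \<in> carrier A"
  show "support_functional c x \<le> 1"
    using support_functional_tendsto [OF c x] c x
    by (rule_tac LIMSEQ_le_const2) (auto intro: functional_le_one)
next
  show "support_functional c \<one> = 1"
    using c by (simp add: support_functional_def)
next
  fix x y assume xy: "x \<in> carrier A" "y \<in> carrier A"
  show "support_functional c x + support_functional c (x \<rightarrow> y) =
      support_functional c y + support_functional c (y \<rightarrow> x)"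
    using support_functional_imp_le [of y "(x \<rightarrow> y) \<leadsto> y" c]
      support_functional_imp_le [of x "(y \<rightarrow> x) \<leadsto> x" c]
      join_commute [of x y] c xy imp_limp_imp [of x y] imp_limp_imp [of y x]
      le_limp_self [of "x \<rightarrow> y" y] le_limp_self [of "y \<rightarrow> x" x]
    by simp
  show "support_functional c x + support_functional c (x \<leadsto> y) =
      support_functional c y + support_functional c (y \<leadsto> x)"
    using support_functional_limp_le [of y "(x \<leadsto> y) \<rightarrow> y" c]
      support_functional_limp_le [of x "(y \<leadsto> x) \<rightarrow> x" c]
      join_commute [of x y] limp_imp_eq_join [of x y] limp_imp_eq_join [of y x] c xy
      limp_imp_limp [of x y] limp_imp_limp [of y x] le_imp_self [of "x \<leadsto> y" y] le_imp_self [of "y \<leadsto> x" x]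
    by simp
qed

end

section \<open>Faithful Bosbach states\<close>

sublocale Bosbach_state \<subseteq> Bosbach_functional
  using state_range state_imp state_limp state_one by unfold_locales auto

locale faithful_Bosbach_state = Bosbach_state + faithful_Bosbach_functional
begin

declare zero_closed [simp, intro] zero_le [simp, intro]

lemma zero_imp [simp]: "x \<in> carrier A \<Longrightarrow> \<zero> \<rightarrow> x = \<one>"
  using le_iff_imp [of \<zero> x] by simp

text \<open>Double negation is the join with the bottom element.\<close>

lemma imp_zero_limp_zero: "x \<in> carrier A \<Longrightarrow> (x \<rightarrow> \<zero>) \<leadsto> \<zero> = x"
  using join_commute [of x \<zero>] by simp

text \<open>Write \<open>y\<close> as its double negation and exchange the premises; this switches
  the arrow.\<close>

lemma contraposition:
  assumes "x \<in> carrier A" "y \<in> carrier A"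
  shows "x \<rightarrow> y = (y \<rightarrow> \<zero>) \<leadsto> (x \<rightarrow> \<zero>)"
  using imp_limp_exchange [of x "y \<rightarrow> \<zero>" \<zero>] assms by (simp add: imp_zero_limp_zero)

text \<open>With \<open>j\<close> the join of \<open>p\<close> and \<open>q\<close> and \<open>P, Q, m\<close> the negations of \<open>p, q, j\<close>, the left-hand
  side is \<open>(Q \<leadsto> m) \<rightarrow> (P \<leadsto> m) = P \<leadsto> ((Q \<leadsto> m) \<rightarrow> m)\<close>, and the join of \<open>Q\<close> and \<open>m\<close> is \<open>Q\<close>.\<close>

lemma prelinearity:
  assumes p: "p \<in> carrier A" and q: "q \<in> carrier A"
  shows "(p \<rightarrow> q) \<rightarrow> (q \<rightarrow> p) = q \<rightarrow> p"
proof -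
  define j where "j = (p \<rightarrow> q) \<leadsto> q"
  define P Q m where "P = p \<rightarrow> \<zero>" and "Q = q \<rightarrow> \<zero>" and "m = j \<rightarrow> \<zero>"
  have car [simp]: "j \<in> carrier A" "P \<in> carrier A" "Q \<in> carrier A" "m \<in> carrier A"
    using p q by (simp_all add: j_def P_def Q_def m_def)
  have "m \<preceq> Q"
    unfolding m_def Q_def using p q by (intro imp_antimono) (auto simp: j_def le_limp_self)
  then have "(m \<leadsto> Q) \<rightarrow> Q = Q"
    by (simp add: le_iff_limp)
  then have join: "(Q \<leadsto> m) \<rightarrow> m = Q"
    using join_commute [of Q m] limp_imp_eq_join [of Q m] limp_imp_eq_join [of m Q] by simp
  \<comment> \<open>Starting both implications from the join gives their contrapositives the common
    conclusion \<open>m\<close>.\<close>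
  have "p \<rightarrow> q = j \<rightarrow> q"
    using p q by (simp add: j_def imp_limp_imp)
  then have c: "p \<rightarrow> q = Q \<leadsto> m"
    using q by (simp add: contraposition [of j q] Q_def m_def)
  have "q \<rightarrow> p = j \<rightarrow> p"
    using p q by (simp add: j_def join_commute [of p q] imp_limp_imp)
  then have d: "q \<rightarrow> p = P \<leadsto> m"
    using p by (simp add: contraposition [of j p] P_def m_def)
  have "(Q \<leadsto> m) \<rightarrow> (P \<leadsto> m) = P \<leadsto> Q"
    by (simp add: imp_limp_exchange join)
  then show ?thesis
    using c d contraposition [OF q p] by (simp add: P_def Q_def)
qed

text \<open>The hypothesis ranges over all functionals because it is applied to the support
  functional of \<open>p \<rightarrow> q\<close>, which depends on \<open>p\<close> and
  \<open>q\<close>.\<close>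

lemma le_if_functionals_agree:
  assumes p: "p \<in> carrier A" and q: "q \<in> carrier A"
    and eq: "\<And>t. Bosbach_functional A t \<Longrightarrow> t p = t q"
  shows "q \<preceq> p"
proof -
  define c where "c = p \<rightarrow> q"
  have c: "c \<in> carrier A"
    using p q by (simp add: c_def)
  interpret \<sigma>: Bosbach_functional A "support_functional c"
    by (rule Bosbach_functional_support_functional [OF c])
  \<comment> \<open>From the first iterate on, \<open>c \<rightarrow> c = \<one>\<close> makes the
    sequence constant; at index 0 it is still \<open>s c\<close>.\<close>
  have "(\<lambda>n. s ((pBCK_imp A c ^^ n) c)) \<longlonglongrightarrow> 1"
  proof (rule tendsto_eventually)
    show "\<forall>\<^sub>F n in sequentially. s ((pBCK_imp A c ^^ n) c) = 1"
      using eventually_gt_at_top [of 0]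
    proof eventually_elim
      case (elim n)
      then obtain k where "n = Suc k"
        by (cases n) auto
      then show ?case
        using c by (simp add: funpow_swap1)
    qed
  qed
  then have "support_functional c c = 1"
    using support_functional_tendsto [OF c c] LIMSEQ_unique by blast
  moreover have "support_functional c (p \<rightarrow> q) = support_functional c (q \<rightarrow> p)"
    using \<sigma>.functional_imp [OF p q] eq [OF \<sigma>.Bosbach_functional_axioms] by simp
  moreover have "(pBCK_imp A c ^^ n) (q \<rightarrow> p) = q \<rightarrow> p" for n
    by (induction n) (use p q in \<open>auto simp: c_def prelinearity\<close>)
  then have "support_functional c (q \<rightarrow> p) = s (q \<rightarrow> p)"
    by (simp add: support_functional_def)
  ultimately have "s (q \<rightarrow> p) = 1"
    by (simp add: c_def)
  then show ?thesis
    using faithful p q by (simp add: le_iff_imp)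
qed

lemma imp_eq_limp:
  assumes "a \<in> carrier A" "b \<in> carrier A"
  shows "a \<rightarrow> b = a \<leadsto> b"
proof -
  have eq: "t (a \<rightarrow> b) = t (a \<leadsto> b)" if "Bosbach_functional A t" for t
    using Bosbach_functional.functional_imp_eq_limp [OF that] assms by blast
  show ?thesis
  proof (rule le_antisym)
    show "a \<rightarrow> b \<preceq> a \<leadsto> b" "a \<leadsto> b \<preceq> a \<rightarrow> b"
      using assms by (auto intro!: le_if_functionals_agree simp: eq)
  qed (use assms in auto)
qed

lemma imp_exchange:
  assumes "x \<in> carrier A" "y \<in> carrier A" "z \<in> carrier A"
  shows "x \<rightarrow> (y \<rightarrow> z) = y \<rightarrow> (x \<rightarrow> z)"
  using imp_limp_exchange [of x y z] assms by (simp add: imp_eq_limp)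

lemma imp_zero_imp_zero [simp]: "x \<in> carrier A \<Longrightarrow> (x \<rightarrow> \<zero>) \<rightarrow> \<zero> = x"
  using imp_zero_limp_zero [of x] by (simp add: imp_eq_limp)

lemma neg_imp_commute:
  assumes "x \<in> carrier A" "y \<in> carrier A"
  shows "(x \<rightarrow> \<zero>) \<rightarrow> y = (y \<rightarrow> \<zero>) \<rightarrow> x"
  using contraposition [of "x \<rightarrow> \<zero>" y] assms imp_eq_limp [of "y \<rightarrow> \<zero>" x] by simp

lemma functional_neg: "x \<in> carrier A \<Longrightarrow> s (x \<rightarrow> \<zero>) = 1 - s x"
  using functional_imp_le [of \<zero> x] state_zero by simp

text \<open>Only the values of the operations on the carrier are prescribed: the unions defining
  \<open>quotient_MV\<close> are compared with the quotient algebra on classes alone.\<close>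

context
  fixes M :: "('a, 'n) MV_scheme" (structure)
  assumes carrier_eq [simp]: "carrier M = carrier A"
    and plus_eq: "\<And>x y. \<lbrakk>x \<in> carrier A; y \<in> carrier A\<rbrakk> \<Longrightarrow> x \<oplus>\<^bsub>M\<^esub> y = pBCK_til A x \<rightarrow> y"
    and neg_eq: "\<And>x. x \<in> carrier A \<Longrightarrow> \<ominus>\<^bsub>M\<^esub> x = pBCK_neg A x"
    and zero_eq [simp]: "MV_zero M = \<zero>"
begin

lemma MV_plus_eq [simp]:
  "\<lbrakk>x \<in> carrier A; y \<in> carrier A\<rbrakk> \<Longrightarrow> x \<oplus>\<^bsub>M\<^esub> y = (x \<rightarrow> \<zero>) \<rightarrow> y"
  by (simp add: plus_eq pBCK_til_def imp_eq_limp)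

lemma MV_neg_eq [simp]: "x \<in> carrier A \<Longrightarrow> \<ominus>\<^bsub>M\<^esub> x = x \<rightarrow> \<zero>"
  by (simp add: neg_eq pBCK_neg_def)

lemma MV_algebra_if_ops_eq: "MV_algebra M"
proof unfold_locales
  fix x y assume "x \<in> carrier M" "y \<in> carrier M"
  then show "x \<oplus>\<^bsub>M\<^esub> y = y \<oplus>\<^bsub>M\<^esub> x"
    using neg_imp_commute by simp
next
  fix x y z assume xyz: "x \<in> carrier M" "y \<in> carrier M" "z \<in> carrier M"
  \<comment> \<open>By commutativity both sides are nested implications into \<open>y\<close> with
    premises \<open>x \<rightarrow> \<zero>\<close> and \<open>z \<rightarrow> \<zero>\<close>, in
    opposite orders.\<close>
  then show "(x \<oplus>\<^bsub>M\<^esub> y) \<oplus>\<^bsub>M\<^esub> z = x \<oplus>\<^bsub>M\<^esub> (y \<oplus>\<^bsub>M\<^esub> z)"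
    using neg_imp_commute [of "(x \<rightarrow> \<zero>) \<rightarrow> y" z] neg_imp_commute [of y z]
      imp_exchange [of "x \<rightarrow> \<zero>" "z \<rightarrow> \<zero>" y] by simp
next
  fix x y assume xy: "x \<in> carrier M" "y \<in> carrier M"
  \<comment> \<open>Each side of the Lukasiewicz axiom is a join, so the axiom reduces to
    \<open>join_commute\<close>.\<close>
  have *: "u \<oplus>\<^bsub>M\<^esub> \<ominus>\<^bsub>M\<^esub> (u \<oplus>\<^bsub>M\<^esub> \<ominus>\<^bsub>M\<^esub> v) = (v \<rightarrow> u) \<leadsto> u"
    if "u \<in> carrier A" "v \<in> carrier A" for u v
    using that neg_imp_commute [of u "v \<rightarrow> \<zero>"] neg_imp_commute [of u "(v \<rightarrow> u) \<rightarrow> \<zero>"]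
      imp_eq_limp [of "v \<rightarrow> u" u] by simp
  show "y \<oplus>\<^bsub>M\<^esub> \<ominus>\<^bsub>M\<^esub> (y \<oplus>\<^bsub>M\<^esub> \<ominus>\<^bsub>M\<^esub> x) = x \<oplus>\<^bsub>M\<^esub> \<ominus>\<^bsub>M\<^esub> (x \<oplus>\<^bsub>M\<^esub> \<ominus>\<^bsub>M\<^esub> y)"
    using * [of x y] * [of y x] join_commute [of x y] xy by simp
qed auto

text \<open>The sum is \<open>(b \<rightarrow> \<zero>) \<rightarrow> a\<close> with comparable
  arguments, of value \<open>1 + s a - (1 - s b)\<close>.\<close>

lemma state_plus:
  assumes "a \<in> carrier A" "b \<in> carrier A" "a \<preceq> b \<rightarrow> \<zero>"
  shows "s (a \<oplus>\<^bsub>M\<^esub> b) = s a + s b"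
  using assms functional_imp_le [of a "b \<rightarrow> \<zero>"] neg_imp_commute [of a b] by (simp add: functional_neg)

lemma MV_mult_closed [simp, intro]: "x \<in> carrier A \<Longrightarrow> MV_mult M n x \<in> carrier A"
  by (induction n) auto

lemma MV_le_iff [simp]:
  "\<lbrakk>x \<in> carrier A; y \<in> carrier A\<rbrakk> \<Longrightarrow> MV_le M x y \<longleftrightarrow> x \<preceq> y"
  by (simp add: MV_le_def le_iff_imp)

text \<open>The assumption makes every sum in the multiples of \<open>x\<close> orthogonal, so
  \<open>s\<close> takes the value \<open>n * s x\<close> on the \<open>n\<close>-th multiple.
  Boundedness gives \<open>s x = 0\<close>, and faithfulness gives
  \<open>x = \<zero>\<close>.\<close>

lemma archimedean_MV_algebra_if_ops_eq: "archimedean_MV_algebra M"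
proof -
  interpret MV: MV_algebra M
    by (rule MV_algebra_if_ops_eq)
  show ?thesis
  proof unfold_locales
    fix x assume "x \<in> carrier M" and le: "MV_le M (MV_mult M n x) (\<ominus>\<^bsub>M\<^esub> x)" for n
    then have x: "x \<in> carrier A"
      by simp
    have mult: "s (MV_mult M n x) = real n * s x" for n
    proof (induction n)
      case (Suc n)
      have "s (MV_mult M n x \<oplus>\<^bsub>M\<^esub> x) = s (MV_mult M n x) + s x"
        using le [of n] x by (intro state_plus) auto
      then show ?case
        using Suc by (simp add: algebra_simps)
    qed (simp add: state_zero)
    have "s x \<le> 0"
    proof (rule ccontr)
      assume "\<not> s x \<le> 0"
      then obtain n where "1 < real n * s x"
        using reals_Archimedean3 [of "s x"] by auto
      then show False
        using mult [of n] functional_le_one [of "MV_mult M n x"] x by simp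
    qed
    then have "s x = 0"
      using state_range [of x] x by auto
    then have "x = \<zero>"
      using eq_if_le_functional_eq [of \<zero> x] x state_zero by simp
    then show "x = MV_zero M"
      by simp
  qed
qed

lemma MV_state_if_ops_eq: "MV_state M s"
proof -
  interpret MV: MV_algebra M
    by (rule MV_algebra_if_ops_eq)
  show ?thesis
  proof unfold_locales
    fix a b
    assume ab: "a \<in> carrier M" "b \<in> carrier M" and "\<ominus>\<^bsub>M\<^esub> (\<ominus>\<^bsub>M\<^esub> a \<oplus>\<^bsub>M\<^esub> \<ominus>\<^bsub>M\<^esub> b) = MV_zero M"
    \<comment> \<open>Negating both sides lets the double negation cancel, leaving
      \<open>a \<rightarrow> b \<rightarrow> \<zero> = \<one>\<close>.\<close>
    then have "((a \<rightarrow> b \<rightarrow> \<zero>) \<rightarrow> \<zero>) \<rightarrow> \<zero> = \<zero> \<rightarrow> \<zero>"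
      by simp
    then have "a \<preceq> b \<rightarrow> \<zero>"
      using ab by (simp add: le_iff_imp)
    then show "s (a \<oplus>\<^bsub>M\<^esub> b) = s a + s b"
      using ab by (simp add: state_plus del: MV_plus_eq)
  qed (use state_range in auto)
qed

end

end

section \<open>The quotient by the kernel\<close>

context Bosbach_state
begin

declare zero_closed [simp, intro]

abbreviation "K \<equiv> state_ker A s"
abbreviation "R \<equiv> filter_rel A K"
abbreviation "cls \<equiv> filter_class A K"

section \<open>The congruence of the kernel\<close>

lemma mem_R_iff:
  "(a, b) \<in> R \<longleftrightarrow> a \<in> carrier A \<and> b \<in> carrier A \<and> s (a \<rightarrow> b) = 1 \<and> s (b \<rightarrow> a) = 1"
  by (auto simp: filter_rel_def state_ker_def)

lemma functional_eq_one_mono: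
  "\<lbrakk>x \<preceq> y; s x = 1; x \<in> carrier A; y \<in> carrier A\<rbrakk> \<Longrightarrow> s y = 1"
  using functional_mono [of x y] functional_le_one [of y] by simp

lemma ker_mp:
  "\<lbrakk>s x = 1; s (x \<rightarrow> y) = 1; x \<in> carrier A; y \<in> carrier A\<rbrakk> \<Longrightarrow> s y = 1"
  using functional_imp [of x y] functional_le_one [of y] functional_le_one [of "y \<rightarrow> x"] by simp

lemma ker_imp_mono:
  assumes "s (a \<rightarrow> b) = 1" "a \<in> carrier A" "b \<in> carrier A" "c \<in> carrier A"
  shows "s ((c \<rightarrow> a) \<rightarrow> (c \<rightarrow> b)) = 1"
  using functional_eq_one_mono [OF imp_prefix [of a b c]] assms by simp

text \<open>\<open>imp_trans\<close> yields an outer \<open>\<leadsto>\<close>; since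
  \<open>s\<close> does not distinguish the arrows, that is, since the kernel is normal, it may be
  read as \<open>\<rightarrow>\<close>.\<close>

lemma ker_imp_antimono:
  assumes "s (a \<rightarrow> b) = 1" "a \<in> carrier A" "b \<in> carrier A" "c \<in> carrier A"
  shows "s ((b \<rightarrow> c) \<rightarrow> (a \<rightarrow> c)) = 1"
  using functional_eq_one_mono [OF imp_trans [of a b c]] assms by (simp add: functional_imp_eq_limp)

lemma ker_limp_mono:
  assumes "s (a \<rightarrow> b) = 1" "a \<in> carrier A" "b \<in> carrier A" "c \<in> carrier A"
  shows "s ((c \<leadsto> a) \<rightarrow> (c \<leadsto> b)) = 1"
  using functional_eq_one_mono [OF limp_prefix [of a b c]] assms by (simp add: functional_imp_eq_limp)

lemma ker_limp_antimono:
  assumes "s (a \<rightarrow> b) = 1" "a \<in> carrier A" "b \<in> carrier A" "c \<in> carrier A"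
  shows "s ((b \<leadsto> c) \<rightarrow> (a \<leadsto> c)) = 1"
  using functional_eq_one_mono [OF limp_trans [of a b c]] assms by (simp add: functional_imp_eq_limp)

lemma ker_trans:
  "\<lbrakk>s (a \<rightarrow> b) = 1; s (b \<rightarrow> c) = 1; a \<in> carrier A; b \<in> carrier A; c \<in> carrier A\<rbrakk>
    \<Longrightarrow> s (a \<rightarrow> c) = 1"
  using ker_mp [OF _ ker_imp_mono [of b c a]] by simp

lemma equiv_R: "equiv (carrier A) R"
proof (rule equivI)
  show "R \<subseteq> carrier A \<times> carrier A"
    by (auto simp: mem_R_iff)
  show "refl_on (carrier A) R"
    by (auto simp: refl_on_def mem_R_iff)
  show "sym R"
    by (auto simp: sym_def mem_R_iff)
  show "trans R"
    by (rule transI) (simp add: mem_R_iff, metis ker_trans)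
qed

lemma R_refl: "a \<in> carrier A \<Longrightarrow> (a, a) \<in> R"
  by (simp add: mem_R_iff)

lemma R_imp:
  assumes "(a, a') \<in> R" "(b, b') \<in> R"
  shows "(a \<rightarrow> b, a' \<rightarrow> b') \<in> R"
proof -
  have "(a \<rightarrow> b, a' \<rightarrow> b) \<in> R" "(a' \<rightarrow> b, a' \<rightarrow> b') \<in> R"
    using assms by (auto simp: mem_R_iff ker_imp_mono ker_imp_antimono)
  then show ?thesis
    using equiv_R by (meson equivE transE)
qed

lemma R_limp:
  assumes "(a, a') \<in> R" "(b, b') \<in> R"
  shows "(a \<leadsto> b, a' \<leadsto> b') \<in> R"
proof -
  have "(a \<leadsto> b, a' \<leadsto> b) \<in> R" "(a' \<leadsto> b, a' \<leadsto> b') \<in> R"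
    using assms by (auto simp: mem_R_iff ker_limp_mono ker_limp_antimono)
  then show ?thesis
    using equiv_R by (meson equivE transE)
qed

lemma cls_eq_iff:
  "\<lbrakk>a \<in> carrier A; b \<in> carrier A\<rbrakk> \<Longrightarrow> cls a = cls b \<longleftrightarrow> (a, b) \<in> R"
  unfolding filter_class_def by (rule eq_equiv_class_iff [OF equiv_R])

lemma cls_eq_one_iff: "a \<in> carrier A \<Longrightarrow> cls a = cls \<one> \<longleftrightarrow> s a = 1"
  by (simp add: cls_eq_iff mem_R_iff)

lemma cls_in_quotient [simp]: "a \<in> carrier A \<Longrightarrow> cls a \<in> carrier A // R"
  unfolding filter_class_def by (rule quotientI)

lemma UN_cls:
  assumes "\<And>a a'. (a, a') \<in> R \<Longrightarrow> (f a, f a') \<in> R" and a: "a \<in> carrier A"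
  shows "(\<Union>x\<in>cls a. cls (f x)) = cls (f a)"
proof -
  have "cls (f x) = cls (f y)" if "(x, y) \<in> R" for x y
    using assms(1) [OF that] by (subst cls_eq_iff) (auto simp: mem_R_iff)
  then have *: "congruent R (\<lambda>x. cls (f x))"
    by (simp add: congruentI)
  show ?thesis
    using UN_equiv_class [OF equiv_R * a] by (simp add: filter_class_def)
qed

lemma UN_cls2:
  assumes "\<And>a a' b b'. \<lbrakk>(a, a') \<in> R; (b, b') \<in> R\<rbrakk> \<Longrightarrow> (f a b, f a' b') \<in> R"
    and a: "a \<in> carrier A" and b: "b \<in> carrier A"
  shows "(\<Union>x\<in>cls a. \<Union>y\<in>cls b. cls (f x y)) = cls (f a b)"
proof -
  have "cls (f x y) = cls (f x' y')" if "(x, x') \<in> R" "(y, y') \<in> R" for x x' y y'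
    using assms(1) [OF that] by (subst cls_eq_iff) (auto simp: mem_R_iff)
  then have *: "congruent2 R R (\<lambda>x y. cls (f x y))"
    by (auto simp: congruent2_def)
  show ?thesis
    using UN_equiv_class2 [OF equiv_R equiv_R * a b] by (simp add: filter_class_def)
qed

text \<open>For related elements both implications have value 1, so the Bosbach identity cancels to
  \<open>s a = s b\<close>; the image of a class is a singleton, as \<open>the_elem\<close>
  requires.\<close>

lemma quotient_map_cls [simp]:
  assumes "a \<in> carrier A"
  shows "quotient_map s (cls a) = s a"
proof -
  have "s b = s a" if "(a, b) \<in> R" for b
    using that functional_imp [of a b] by (simp add: mem_R_iff)
  moreover have "a \<in> cls a"
    using R_refl [OF assms] by (simp add: filter_class_def)
  ultimately have "s ` cls a = {s a}"
    unfolding filter_class_def by blast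
  then show ?thesis
    by (simp add: quotient_map_def)
qed

text \<open>The order is read off from the arrow, since classes may be comparable although given
  representatives are not.\<close>

definition Q :: "'a set bounded_pseudo_BCK" where
  "Q = \<lparr>carrier = carrier A // R,
     pBCK_le = (\<lambda>X Y. (\<Union>a\<in>X. \<Union>b\<in>Y. cls (a \<rightarrow> b)) = cls \<one>),
     pBCK_imp = (\<lambda>X Y. \<Union>a\<in>X. \<Union>b\<in>Y. cls (a \<rightarrow> b)),
     pBCK_limp = (\<lambda>X Y. \<Union>a\<in>X. \<Union>b\<in>Y. cls (a \<leadsto> b)),
     pBCK_one = cls \<one>,
     pBCK_zero = cls \<zero>\<rparr>"

lemma Q_simps [simp]:
  "carrier Q = carrier A // R" "\<one>\<^bsub>Q\<^esub> = cls \<one>" "\<zero>\<^bsub>Q\<^esub> = cls \<zero>"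
  "\<lbrakk>a \<in> carrier A; b \<in> carrier A\<rbrakk> \<Longrightarrow> cls a \<rightarrow>\<^bsub>Q\<^esub> cls b = cls (a \<rightarrow> b)"
  "\<lbrakk>a \<in> carrier A; b \<in> carrier A\<rbrakk> \<Longrightarrow> cls a \<leadsto>\<^bsub>Q\<^esub> cls b = cls (a \<leadsto> b)"
  "\<lbrakk>a \<in> carrier A; b \<in> carrier A\<rbrakk> \<Longrightarrow> cls a \<preceq>\<^bsub>Q\<^esub> cls b \<longleftrightarrow> s (a \<rightarrow> b) = 1"
  by (simp_all add: Q_def UN_cls2 R_imp R_limp cls_eq_one_iff)

lemma functional_imp_eq_one: "\<lbrakk>x \<preceq> y; x \<in> carrier A; y \<in> carrier A\<rbrakk> \<Longrightarrow> s (x \<rightarrow> y) = 1"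
  by (simp add: le_iff_imp)

lemma carrier_QE:
  assumes "X \<in> carrier Q"
  obtains a where "a \<in> carrier A" "X = cls a"
  using assms unfolding Q_simps(1) filter_class_def by (rule quotientE)

text \<open>On representatives, an inequality of classes says that an implication has value 1, so
  inequalities of \<open>A\<close> descend; faithfulness holds because the class of
  \<open>\<one>\<close> is the kernel.\<close>

lemma faithful_Bosbach_state_quotient: "faithful_Bosbach_state Q (quotient_map s)"
  by (unfold_locales; (elim carrier_QE)?; (hypsubst)?)
    (use state_range in \<open>simp_all add: cls_eq_one_iff cls_eq_iff mem_R_iff state_zero functional_imp
        functional_limp functional_imp_eq_one imp_trans limp_trans le_imp_limp le_limp_imp zero_le
      flip: functional_imp_eq_limp\<close>)

lemma quotient_MV_simps:
  "carrier (quotient_MV A K) = carrier A // R" "MV_zero (quotient_MV A K) = cls \<zero>"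
  "\<lbrakk>a \<in> carrier A; b \<in> carrier A\<rbrakk>
    \<Longrightarrow> cls a \<oplus>\<^bsub>quotient_MV A K\<^esub> cls b = cls (pBCK_til A a \<rightarrow> b)"
  "a \<in> carrier A \<Longrightarrow> \<ominus>\<^bsub>quotient_MV A K\<^esub> cls a = cls (pBCK_neg A a)"
  by (simp_all add: quotient_MV_def pBCK_til_def pBCK_neg_def UN_cls UN_cls2 R_imp R_limp R_refl)

lemma archimedean_MV_state_quotient:
  "archimedean_MV_algebra (quotient_MV A K) \<and> MV_state (quotient_MV A K) (quotient_map s)"
proof -
  interpret Q: faithful_Bosbach_state Q "quotient_map s"
    by (rule faithful_Bosbach_state_quotient)
  have "X \<oplus>\<^bsub>quotient_MV A K\<^esub> Y = pBCK_til Q X \<rightarrow>\<^bsub>Q\<^esub> Y" if "X \<in> carrier Q" "Y \<in> carrier Q" for X Y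
    using that by (elim carrier_QE) (simp add: quotient_MV_simps pBCK_til_def)
  moreover have "\<ominus>\<^bsub>quotient_MV A K\<^esub> X = pBCK_neg Q X" if "X \<in> carrier Q" for X
    using that by (elim carrier_QE) (simp add: quotient_MV_simps pBCK_neg_def)
  ultimately show ?thesis
    by (intro conjI Q.archimedean_MV_algebra_if_ops_eq Q.MV_state_if_ops_eq) (simp_all add: quotient_MV_simps)
qed

end

theorem theorem3p20:
  fixes A :: "('a, 'm) bounded_pseudo_BCK_scheme" and s :: "'a \<Rightarrow> real"
  assumes "bounded_pseudo_BCK_algebra A"
    and "Bosbach_state A s"
  defines "K \<equiv> state_ker A s"
  defines "M \<equiv> quotient_MV A K"
  shows "(\<forall>a\<in>carrier A. \<forall>b\<in>carrier A.
            filter_class A K a \<oplus>\<^bsub>M\<^esub> filter_class A K b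
              = filter_class A K (pBCK_til A a \<rightarrow>\<^bsub>A\<^esub> b)) \<and>
         (\<forall>a\<in>carrier A. \<ominus>\<^bsub>M\<^esub> filter_class A K a = filter_class A K (pBCK_neg A a)) \<and>
         archimedean_MV_algebra M \<and>
         (\<forall>a\<in>carrier A. quotient_map s (filter_class A K a) = s a) \<and>
         MV_state M (quotient_map s)"
proof -
  interpret Bosbach_state A s
    by (rule assms(2))
  show ?thesis
    unfolding M_def K_def using archimedean_MV_state_quotient by (simp add: quotient_MV_simps)
qed

end
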